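(* Let $(\mathcal{X},\|\cdot\|)$ be a separable $(2,D)$-smooth Banach space, $\mathcal{X}\neq\{0\}$, let $B>0$ and $\mu\in\mathcal{X}$, and let $X_1,X_2,\ldots$ be $\mathcal{X}$-valued random variables such that $$\mathbb{E}[X_{t+1}\mid\mathcal{F}_t]=\mu \quad\text{for all } t\ge 0,\qquad \|X_t\|\le B\quad\text{for all } t\ge 1,$$ where $\mathcal{F}_t=\sigma(X_1,\ldots,X_t)$ and $\mathcal{F}_0$ is trivial. Let $(\lambda_t)_{t\ge1}$ be any predictable sequence with values in $(0,0.8]$. Define $\psi_E(\lambda)=-\log(1-\lambda)-\lambda$ and $$\bar\mu_0=0,\qquad \bar\mu_i=\frac{\sum_{j=1}^i\lambda_jX_j}{\sum_{j=1}^i\lambda_j},\quad i\ge1.$$ Then the process $$S_t=\cosh\left(\left\|\sum_{i=1}^t\lambda_i\frac{X_i-\mu}{4BD}\right\|\right)\exp\left(-\sum_{i=1}^t\frac{\psi_E(\lambda_i)}{(4B)^2}\|X_i-\bar\mu_{i-1}\|^2\right),\quad t\ge 0$$ (with $S_0=1$), is a nonnegative supermartingale with respect to $(\mathcal{F}_t)_{t\ge0}$.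
   Context: A Banach space $(\mathcal{X},\|\cdot\|)$ is called $(2,D)$-smooth, for some $D>0$, if $\|x+y\|^2+\|x-y\|^2\le 2\|x\|^2+2D^2\|y\|^2$ for all $x,y\in\mathcal{X}$ (if $\mathcal{X}\ne\{0\}$ this forces $D\ge1$). A process $(\lambda_t)_{t\ge1}$ is predictable if $\lambda_t$ is $\mathcal{F}_{t-1}$-measurable for every $t$. An integrable adapted real process $(M_t)$ is a supermartingale if $\mathbb{E}[M_{t+1}\mid\mathcal{F}_t]\le M_t$ for all $t$. Equalities and inequalities between random variables hold almost surely. *)

theory Defs
  imports "HOL-Probability.Probability"
begin

definition two_smooth :: "'a::real_normed_vector itself \<Rightarrow> real \<Rightarrow> bool" where
  "two_smooth (_ :: 'a itself) D \<longleftrightarrow>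
     D > 0 \<and>
     (\<forall>x y :: 'a. (norm (x + y))\<^sup>2 + (norm (x - y))\<^sup>2 \<le> 2 * (norm x)\<^sup>2 + 2 * D\<^sup>2 * (norm y)\<^sup>2)"

text \<open>The library's conditional expectation is real-valued only. For Banach-valued (Bochner
  integrable) \<open>f\<close>, the predicate below says that \<open>g\<close> is a version of the conditional expectation
  of \<open>f\<close> given \<open>F\<close>.\<close>

definition is_cond_exp ::
    "'w measure \<Rightarrow> 'w measure \<Rightarrow> ('w \<Rightarrow> 'a::{banach, second_countable_topology}) \<Rightarrow> ('w \<Rightarrow> 'a) \<Rightarrow> bool"
  where
  "is_cond_exp M F f g \<longleftrightarrow>
     subalgebra M F \<and> integrable M f \<and> integrable M g \<and> g \<in> borel_measurable F \<and>
     (\<forall>A\<in>sets F. (LINT w:A|M. f w) = (LINT w:A|M. g w))"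

text \<open>The \<open>\<sigma>\<close>-algebra generated by \<open>X 1, \<dots>, X t\<close> (\<open>X 0\<close> is never used). For \<open>t = 0\<close> the
  generator is empty, which gives the trivial \<open>\<sigma>\<close>-algebra on \<open>space M\<close>.\<close>

definition nat_filt :: "'w measure \<Rightarrow> (nat \<Rightarrow> 'w \<Rightarrow> 'a::topological_space) \<Rightarrow> nat \<Rightarrow> 'w measure" where
  "nat_filt M X t =
     sigma (space M) {X i -` A \<inter> space M | i A. i \<in> {1..t} \<and> A \<in> sets borel}"

definition is_predictable :: "(nat \<Rightarrow> 'w measure) \<Rightarrow> (nat \<Rightarrow> 'w \<Rightarrow> 'b::topological_space) \<Rightarrow> bool" where
  "is_predictable F lam \<longleftrightarrow> (\<forall>t\<ge>1. lam t \<in> borel_measurable (F (t - 1)))"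

definition is_supermartingale :: "'w measure \<Rightarrow> (nat \<Rightarrow> 'w measure) \<Rightarrow> (nat \<Rightarrow> 'w \<Rightarrow> real) \<Rightarrow> bool" where
  "is_supermartingale M F S \<longleftrightarrow>
     filtration (space M) F \<and>
     (\<forall>t. subalgebra M (F t)) \<and>
     (\<forall>t. S t \<in> borel_measurable (F t)) \<and>
     (\<forall>t. integrable M (S t)) \<and>
     (\<forall>t. AE w in M. real_cond_exp M (F t) (S (t + 1)) w \<le> S t w)"

definition psi_E :: "real \<Rightarrow> real" where
  "psi_E l = - ln (1 - l) - l"

definition mu_bar :: "(nat \<Rightarrow> 'w \<Rightarrow> real) \<Rightarrow> (nat \<Rightarrow> 'w \<Rightarrow> 'a::real_vector) \<Rightarrow> nat \<Rightarrow> 'w \<Rightarrow> 'a" where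
  "mu_bar lam X i w =
     (if i = 0 then 0
      else (\<Sum>j=1..i. lam j w *\<^sub>R X j w) /\<^sub>R (\<Sum>j=1..i. lam j w))"

definition S_proc ::
    "real \<Rightarrow> real \<Rightarrow> 'a::real_normed_vector \<Rightarrow> (nat \<Rightarrow> 'w \<Rightarrow> real) \<Rightarrow> (nat \<Rightarrow> 'w \<Rightarrow> 'a) \<Rightarrow> nat \<Rightarrow> 'w \<Rightarrow> real"
  where
  "S_proc B D \<mu> lam X t w =
     cosh (norm (\<Sum>i=1..t. lam i w *\<^sub>R ((X i w - \<mu>) /\<^sub>R (4 * B * D)))) *
     exp (- (\<Sum>i=1..t. psi_E (lam i w) / (4 * B)\<^sup>2 * (norm (X i w - mu_bar lam X (i - 1) w))\<^sup>2))"

end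

theory Submission
  imports Defs
begin

text \<open>Write \<open>\<phi> = cosh \<circ> norm\<close>. Comparing power series, \<open>(2, D)\<close>-smoothness gives
  \<open>\<phi> (x + y) + \<phi> (x - y) \<le> 2 \<phi> x cosh (D \<parallel>y\<parallel>)\<close>. Together with convexity this makes the directional
  derivative \<open>L\<close> of \<open>\<phi>\<close> at \<open>p\<close> linear, and integrating the resulting second-order
  inequality along a segment (in discrete form) yields
  \<open>\<phi> (p + v) \<le> \<phi> p cosh a + L v sinh a / a\<close> with \<open>a = D \<parallel>v\<parallel>\<close>. If \<open>a = l x\<close> with \<open>0 \<le> x \<le> 1\<close>, Fan's
  inequality \<open>exp (\<plusminus> l x - psi_E l x\<^sup>2) \<le> 1 \<plusminus> l x\<close> turns this into
  \<open>\<phi> (p + v) exp (- psi_E l x\<^sup>2) \<le> \<phi> p + L v\<close>. For \<open>f\<close> the current sum, \<open>m\<close> the current weighted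
  mean and \<open>l\<close> the next weight, take \<open>p = f + l (m - \<mu>) / (4 B D)\<close> and \<open>v = l (X - m) / (4 B D)\<close>: the
  conditional mean of the right-hand side is \<open>\<phi> p + L (f - p) \<le> \<phi> f\<close>. Since \<open>L\<close> depends on the past,
  the conditional bound is first proved for simple \<open>(f, l, m)\<close> and then extended by
  dominated convergence, which avoids measurability of \<open>L\<close>.\<close>

section \<open>Smoothness of \<open>cosh \<circ> norm\<close>\<close>

text \<open>Weak majorization for the convex increasing function \<open>x ^ n\<close> on the
  nonnegative reals. If the smaller number \<open>q\<close> exceeds \<open>Q\<close>, then
  \<open>q - Q \<le> P - p\<close>; tangents at \<open>q\<close> and \<open>p\<close> bound the loss
  and the gain, and the slope at \<open>p\<close> is the larger one.\<close>

lemma sum_powers_majorize: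
  fixes p q P Q :: real
  assumes "0 \<le> p" "0 \<le> q" "0 \<le> Q" "p \<le> P" "q \<le> P" "p + q \<le> P + Q"
  shows "p ^ n + q ^ n \<le> P ^ n + Q ^ n"
  using assms
proof (induction p q rule: linorder_wlog)
  case (le q p)
  have tangent: "x ^ n + real n * x ^ (n - 1) * (y - x) \<le> y ^ n" if "0 \<le> x" "0 \<le> y" for x y :: real
  proof -
    have "y ^ n - x ^ n - real n * x ^ (n - 1) * (y - x) \<ge> 0"
    proof (induction n)
      case (Suc n)
      have "y ^ Suc n - x ^ Suc n - real (Suc n) * x ^ n * (y - x)
          = y * (y ^ n - x ^ n - real n * x ^ (n - 1) * (y - x)) + real n * x ^ (n - 1) * (y - x)\<^sup>2"
        by (cases n) (auto simp: algebra_simps power2_eq_square)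
      then show ?case
        using Suc that by simp
    qed auto
    then show ?thesis by linarith
  qed
  show ?case
  proof (cases "q \<le> Q")
    case True
    then show ?thesis
      using le power_mono[of p P n] power_mono[of q Q n] by linarith
  next
    case False
    have "q ^ n - Q ^ n \<le> real n * q ^ (n - 1) * (q - Q)"
      using tangent[of q Q] le by (simp add: algebra_simps)
    also have "\<dots> \<le> real n * p ^ (n - 1) * (P - p)"
      using le False by (intro mult_mono power_mono) auto
    also have "\<dots> \<le> P ^ n - p ^ n"
      using tangent[of p P] le by (simp add: algebra_simps)
    finally show ?thesis by simp
  qed
next
  case (sym q p)
  then show ?case by (simp add: add.commute)
qed

lemma sums_cosh_real: "(\<lambda>n. (x\<^sup>2) ^ n / fact (2 * n)) sums cosh (x::real)"
proof -
  have "(\<lambda>n. if even n then x ^ n /\<^sub>R fact n else 0) sums cosh x"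
    by (rule cosh_converges)
  then have "(\<lambda>n. x ^ (2 * n) /\<^sub>R fact (2 * n)) sums cosh x"
    by (subst (asm) sums_mono_reindex[of "\<lambda>n. 2 * n", symmetric])
       (auto simp: strict_mono_def elim!: evenE)
  then show ?thesis
    by (simp add: power_mult[of x 2] divide_inverse mult.commute[of _ "inverse _"])
qed

text \<open>\<open>cosh\<close> is a power series in the squared argument with nonnegative
  coefficients, so the majorization of squares can be applied term by term.\<close>

lemma cosh_add_cosh_le:
  fixes a b c d :: real
  assumes "a\<^sup>2 + b\<^sup>2 \<le> c\<^sup>2 + d\<^sup>2" "\<bar>a\<bar> \<le> \<bar>c\<bar>" "\<bar>b\<bar> \<le> \<bar>c\<bar>"
  shows "cosh a + cosh b \<le> cosh c + cosh d"
proof (rule sums_le)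
  show "(\<lambda>n. (a\<^sup>2) ^ n / fact (2 * n) + (b\<^sup>2) ^ n / fact (2 * n)) sums (cosh a + cosh b)"
    by (intro sums_add sums_cosh_real)
  show "(\<lambda>n. (c\<^sup>2) ^ n / fact (2 * n) + (d\<^sup>2) ^ n / fact (2 * n)) sums (cosh c + cosh d)"
    by (intro sums_add sums_cosh_real)
  show "(a\<^sup>2) ^ n / fact (2 * n) + (b\<^sup>2) ^ n / fact (2 * n)
      \<le> (c\<^sup>2) ^ n / fact (2 * n) + (d\<^sup>2) ^ n / fact (2 * n)" for n
  proof -
    have "(a\<^sup>2) ^ n + (b\<^sup>2) ^ n \<le> (c\<^sup>2) ^ n + (d\<^sup>2) ^ n"
      by (rule sum_powers_majorize) (use assms in \<open>simp_all add: abs_le_square_iff\<close>)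
    then show ?thesis
      unfolding add_divide_distrib[symmetric] by (rule divide_right_mono) simp
  qed
qed

section \<open>Two-point inequality for \<open>cosh (norm x)\<close>\<close>

lemma two_smooth_ge_1:
  assumes "two_smooth TYPE('a::real_normed_vector) D" "\<exists>x::'a. x \<noteq> 0"
  shows "D \<ge> 1"
proof -
  obtain x :: 'a where "x \<noteq> 0" using assms(2) by blast
  have "(norm (0 + x))\<^sup>2 + (norm (0 - x))\<^sup>2 \<le> 2 * (norm (0::'a))\<^sup>2 + 2 * D\<^sup>2 * (norm x)\<^sup>2"
    using assms(1) unfolding two_smooth_def by blast
  then have "D\<^sup>2 \<ge> 1\<^sup>2" using \<open>x \<noteq> 0\<close> by simp
  then show ?thesis
    using assms(1) power2_le_imp_le[of 1 D] unfolding two_smooth_def by simp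
qed

text \<open>The smoothness bound equals \<open>(norm x + z)\<^sup>2 + (norm x - z)\<^sup>2\<close>
  with \<open>z = D * norm y\<close>. This reduces the claim to four real numbers, and the addition
  formulas for \<open>cosh\<close> finish it.\<close>

lemma cosh_norm_midpoint:
  fixes x y :: "'a::real_normed_vector"
  assumes "two_smooth TYPE('a) D" "D \<ge> 1"
  shows "cosh (norm (x + y)) + cosh (norm (x - y)) \<le> 2 * cosh (norm x) * cosh (D * norm y)"
proof -
  let ?z = "D * norm y"
  \<comment> \<open>Here \<open>D \<ge> 1\<close> enters: by the triangle inequality
    \<open>norm x + ?z\<close> then dominates both norms on the left, as the majorization
    requires.\<close>
  have z: "norm y \<le> ?z" using assms(2) by (simp add: mult_le_cancel_right1)
  have "(norm (x + y))\<^sup>2 + (norm (x - y))\<^sup>2 \<le> 2 * (norm x)\<^sup>2 + 2 * D\<^sup>2 * (norm y)\<^sup>2"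
    using assms(1) unfolding two_smooth_def by blast
  also have "\<dots> = (norm x + ?z)\<^sup>2 + (norm x - ?z)\<^sup>2"
    by (simp add: power2_eq_square algebra_simps)
  finally have "cosh (norm (x + y)) + cosh (norm (x - y))
      \<le> cosh (norm x + ?z) + cosh (norm x - ?z)"
    using norm_triangle_ineq[of x y] norm_triangle_ineq4[of x y] z
    by (intro cosh_add_cosh_le) (auto simp: abs_le_iff)
  also have "\<dots> = 2 * cosh (norm x) * cosh ?z"
    by (simp add: cosh_add cosh_diff)
  finally show ?thesis .
qed

section \<open>Convexity, linear derivative and upper expansion\<close>

lemma convex_cosh_norm: "convex_on UNIV (\<lambda>x::'a::real_normed_vector. cosh (norm x))"
proof (rule convex_onI)
  fix t :: real and x y :: 'a
  assume t: "0 < t" "t < 1"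
  have cosh_convex: "convex_on UNIV (cosh :: real \<Rightarrow> real)"
    by (rule f''_ge0_imp_convex[where f' = sinh and f'' = cosh])
       (auto intro!: derivative_eq_intros)
  have "norm ((1 - t) *\<^sub>R x + t *\<^sub>R y) \<le> (1 - t) * norm x + t * norm y"
    using t by (intro order_trans[OF norm_triangle_ineq]) auto
  then have "cosh (norm ((1 - t) *\<^sub>R x + t *\<^sub>R y)) \<le> cosh ((1 - t) *\<^sub>R norm x + t *\<^sub>R norm y)"
    using t by (subst cosh_real_nonneg_le_iff) auto
  also have "\<dots> \<le> (1 - t) * cosh (norm x) + t * cosh (norm y)"
    using t by (intro convex_onD[OF cosh_convex]) auto
  finally show "cosh (norm ((1 - t) *\<^sub>R x + t *\<^sub>R y)) \<le> (1 - t) * cosh (norm x) + t * cosh (norm y)" .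
qed simp

text \<open>Follows from \<open>cosh (a + b) \<le> cosh a * exp b\<close> for nonnegative
  \<open>a\<close>, \<open>b\<close>. It supplies the constant \<open>C = cosh (norm p)\<close> that
  keeps the difference quotients at \<open>p\<close> bounded below.\<close>

lemma cosh_norm_lower:
  fixes p v :: "'a::real_normed_vector"
  shows "cosh (norm p) - cosh (norm p) * norm v \<le> cosh (norm (p + v))"
proof -
  have "norm p \<le> norm (p + v) + norm v"
    using norm_triangle_ineq4[of "p + v" v] by simp
  then have "cosh (norm p) \<le> cosh (norm (p + v) + norm v)"
    by (subst cosh_real_nonneg_le_iff) auto
  also have "\<dots> = cosh (norm (p + v)) * cosh (norm v) + sinh (norm (p + v)) * sinh (norm v)"
    by (rule cosh_add)
  also have "\<dots> \<le> cosh (norm (p + v)) * cosh (norm v) + cosh (norm (p + v)) * sinh (norm v)"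
    by (intro add_left_mono mult_right_mono) (auto simp: sinh_le_cosh_real)
  also have "\<dots> = cosh (norm (p + v)) * exp (norm v)"
    by (simp add: sinh_def cosh_def algebra_simps)
  finally have "cosh (norm p) * exp (- norm v) \<le> cosh (norm (p + v)) * exp (norm v) * exp (- norm v)"
    by (intro mult_right_mono) auto
  then have "cosh (norm p) * exp (- norm v) \<le> cosh (norm (p + v))"
    by (simp add: mult.assoc flip: exp_add)
  moreover have "cosh (norm p) * (1 - norm v) \<le> cosh (norm p) * exp (- norm v)"
    using exp_ge_add_one_self[of "- norm v"] by (intro mult_left_mono) auto
  ultimately show ?thesis by (simp add: algebra_simps)
qed

text \<open>By convexity the difference quotients decrease to \<open>L v\<close> as \<open>t\<close>
  falls to 0, and \<open>L\<close> is sublinear. The vanishing symmetric second difference makes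
  \<open>L\<close> odd, and an odd sublinear map is linear. The lower bound keeps the infimum finite
  and makes \<open>L\<close> bounded.\<close>

lemma convex_smooth_directional_derivative:
  fixes g :: "'a::real_normed_vector \<Rightarrow> real"
  assumes conv: "convex_on UNIV g"
    and smooth: "\<And>v. ((\<lambda>t. (g (p + t *\<^sub>R v) + g (p - t *\<^sub>R v) - 2 * g p) / t) \<longlongrightarrow> 0) (at_right 0)"
    and lower: "\<And>v. g p - C * norm v \<le> g (p + v)"
  obtains L where "bounded_linear L" "\<And>v. g p + L v \<le> g (p + v)" "\<And>v. \<bar>L v\<bar> \<le> C * norm v"
    "\<And>v. ((\<lambda>t. (g (p + t *\<^sub>R v) - g p) / t) \<longlongrightarrow> L v) (at_right 0)"
proof -
  define q where "q v t = (g (p + t *\<^sub>R v) - g p) / t" for v t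
  define L where "L v = Inf (q v ` {0<..})" for v
  have q_lower: "- (C * norm v) \<le> q v t" if "t > 0" for v t
    using lower[of "t *\<^sub>R v"] that by (simp add: q_def field_simps)
  have q_mono: "q v s \<le> q v t" if "0 < s" "s \<le> t" for v s t
  proof -
    have "(1 - s / t) *\<^sub>R p + (s / t) *\<^sub>R (p + t *\<^sub>R v) = p + s *\<^sub>R v"
      using that by (simp add: algebra_simps)
    then have "g (p + s *\<^sub>R v) \<le> (1 - s / t) * g p + (s / t) * g (p + t *\<^sub>R v)"
      using convex_onD[OF conv, of "s / t" p "p + t *\<^sub>R v"] that by simp
    then have "g (p + s *\<^sub>R v) - g p \<le> s * ((g (p + t *\<^sub>R v) - g p) / t)"
      by (simp add: algebra_simps diff_divide_distrib)
    then show ?thesis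
      using that by (simp add: q_def field_simps)
  qed
  have bdd: "bdd_below (q v ` {0<..})" for v
    using q_lower by (intro bdd_belowI2[where m = "- (C * norm v)"]) auto
  have L_le_q: "L v \<le> q v t" if "t > 0" for v t
    unfolding L_def using that bdd by (intro cInf_lower) auto
  have q_lim: "(q v \<longlongrightarrow> L v) (at_right 0)" for v
  proof (rule order_tendstoI)
    fix a assume "a < L v"
    then show "\<forall>\<^sub>F t in at_right 0. a < q v t"
      using L_le_q by (intro eventually_at_rightI[of 0 1]) (auto intro: less_le_trans)
  next
    fix a assume "L v < a"
    then obtain t where t: "t > 0" "q v t < a"
      unfolding L_def by (subst (asm) cInf_less_iff) (use bdd in auto)
    then show "\<forall>\<^sub>F t in at_right 0. q v t < a"
      by (intro eventually_at_rightI[of 0 t]) (auto intro!: le_less_trans[OF q_mono[of _ t]])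
  qed
  have q_scale_lim: "((\<lambda>t. q v (c * t)) \<longlongrightarrow> L v) (at_right 0)" if "c > 0" for v c
  proof (rule filterlim_compose[OF q_lim])
    show "filterlim (\<lambda>t. c * t) (at_right 0) (at_right 0)"
      unfolding filterlim_at using that
      by (auto intro!: tendsto_eq_intros eventually_at_right_less[THEN eventually_mono])
  qed
  have odd: "L (- v) = - L v" for v
  proof -
    have "((\<lambda>t. q v t + q (- v) t) \<longlongrightarrow> L v + L (- v)) (at_right 0)"
      by (intro tendsto_add q_lim)
    moreover have "(\<lambda>t. q v t + q (- v) t) = (\<lambda>t. (g (p + t *\<^sub>R v) + g (p - t *\<^sub>R v) - 2 * g p) / t)"
      by (simp add: q_def add_divide_distrib diff_divide_distrib fun_eq_iff)
    ultimately have "L v + L (- v) = 0"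
      using tendsto_unique[OF _ _ smooth[of v]] by fastforce
    then show ?thesis by simp
  qed
  \<comment> \<open>The point \<open>p + t *\<^sub>R (v + w)\<close> is the midpoint of
    \<open>p + (2 * t) *\<^sub>R v\<close> and \<open>p + (2 * t) *\<^sub>R w\<close>; the doubled
    step disappears in the limit.\<close>
  have subadd: "L (v + w) \<le> L v + L w" for v w
  proof (rule tendsto_le)
    show "((\<lambda>t. q v (2 * t) + q w (2 * t)) \<longlongrightarrow> L v + L w) (at_right 0)"
      by (intro tendsto_add q_scale_lim) auto
    show "\<forall>\<^sub>F t in at_right 0. q (v + w) t \<le> q v (2 * t) + q w (2 * t)"
    proof (rule eventually_at_right_less[THEN eventually_mono])
      fix t :: real assume t: "t > 0"
      have "(1/2) *\<^sub>R (p + (2 * t) *\<^sub>R v) + (1/2) *\<^sub>R (p + (2 * t) *\<^sub>R w)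
          = (1/2) *\<^sub>R p + (1/2) *\<^sub>R p + t *\<^sub>R (v + w)"
        by (simp add: scaleR_add_right del: scaleR_half_double)
      also have "\<dots> = p + t *\<^sub>R (v + w)"
        by (simp flip: scaleR_add_left)
      finally have "g (p + t *\<^sub>R (v + w)) \<le> g (p + (2 * t) *\<^sub>R v) / 2 + g (p + (2 * t) *\<^sub>R w) / 2"
        using convex_onD[OF conv, of "1/2" "p + (2 * t) *\<^sub>R v" "p + (2 * t) *\<^sub>R w"] by simp
      then have "2 * (g (p + t *\<^sub>R (v + w)) - g p)
          \<le> (g (p + (2 * t) *\<^sub>R v) - g p) + (g (p + (2 * t) *\<^sub>R w) - g p)"
        by simp
      then have "2 * (g (p + t *\<^sub>R (v + w)) - g p) / (2 * t)
          \<le> ((g (p + (2 * t) *\<^sub>R v) - g p) + (g (p + (2 * t) *\<^sub>R w) - g p)) / (2 * t)"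
        using t by (intro divide_right_mono) auto
      then show "q (v + w) t \<le> q v (2 * t) + q w (2 * t)"
        unfolding q_def by (simp only: add_divide_distrib mult_divide_mult_cancel_left_if) simp
    qed
  qed (auto intro: q_lim)
  \<comment> \<open>Subadditivity at \<open>- v\<close> and \<open>- w\<close>, combined with
    oddness, is the reverse inequality.\<close>
  have add: "L (v + w) = L v + L w" for v w
    using subadd[of v w] subadd[of "- v" "- w"] odd[of "v + w"] odd[of v] odd[of w] by simp
  have scale_pos: "L (c *\<^sub>R v) = c * L v" if "c > 0" for c v
  proof (rule tendsto_unique[OF _ q_lim])
    have "(\<lambda>t. q (c *\<^sub>R v) t) = (\<lambda>t. c * q v (c * t))"
      using that by (auto simp: q_def fun_eq_iff mult.commute)
    then show "(q (c *\<^sub>R v) \<longlongrightarrow> c * L v) (at_right 0)"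
      using tendsto_mult[OF tendsto_const q_scale_lim[OF that]] by simp
  qed simp
  have zero: "L 0 = 0"
    using odd[of 0] by simp
  have scale: "L (c *\<^sub>R v) = c * L v" for c v
    using scale_pos[of c v] scale_pos[of "- c" v] odd[of "c *\<^sub>R v"] zero
    by (cases c "0::real" rule: linorder_cases) auto
  have bound: "\<bar>L v\<bar> \<le> C * norm v" for v
  proof -
    have "- (C * norm v) \<le> L v" for v
      using q_lower by (intro tendsto_lowerbound[OF q_lim eventually_at_right_less[THEN eventually_mono]]) auto
    from this[of v] this[of "- v"] show ?thesis
      by (simp add: odd)
  qed
  show thesis
  proof
    show "bounded_linear L"
      using bound by (intro bounded_linear_intro[of L C]) (auto simp: add scale mult.commute)
    show "g p + L v \<le> g (p + v)" for v
      using L_le_q[of 1 v] by (simp add: q_def)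
    show "((\<lambda>t. (g (p + t *\<^sub>R v) - g p) / t) \<longlongrightarrow> L v) (at_right 0)" for v
      using q_lim[of v] by (simp add: q_def[abs_def])
  qed (rule bound)
qed

text \<open>Discrete Sturm comparison. The right-hand side \<open>w\<close> solves the recursion
  with equality and agrees with \<open>u\<close> at 0 and 1. The gap \<open>w - u\<close> therefore
  starts at 0, and as long as it is nonnegative its increments do not decrease.\<close>

lemma discrete_cosh_comparison:
  fixes u :: "nat \<Rightarrow> real"
  assumes h: "h > 0" and rec: "\<And>k. u (k + 2) + u k \<le> 2 * u (k + 1) * cosh h"
  shows "u n \<le> u 0 * cosh (n * h) + (u 1 - u 0 * cosh h) / sinh h * sinh (n * h)"
proof -
  define b where "b = (u 1 - u 0 * cosh h) / sinh h"
  define w where "w n = u 0 * cosh (real n * h) + b * sinh (real n * h)" for n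
  have w_rec: "w (k + 2) + w k = 2 * w (k + 1) * cosh h" for k
  proof -
    define s where "s = real (k + 1) * h"
    have "real (k + 2) * h = s + h" "real k * h = s - h"
      by (simp_all add: s_def algebra_simps)
    then have "w (k + 2) = u 0 * cosh (s + h) + b * sinh (s + h)"
      and "w k = u 0 * cosh (s - h) + b * sinh (s - h)"
      and "w (k + 1) = u 0 * cosh s + b * sinh s"
      by (simp_all only: w_def s_def)
    then show ?thesis
      by (simp only: cosh_add cosh_diff sinh_add sinh_diff) (simp add: algebra_simps)
  qed
  \<comment> \<open>Both halves are needed together: nonnegativity of the next gap permits dropping
    the factor \<open>cosh h \<ge> 1\<close>, which in turn carries monotonicity one step
    further.\<close>
  have "0 \<le> w k - u k \<and> w k - u k \<le> w (k + 1) - u (k + 1)" for k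
  proof (induction k)
    case 0
    then show ?case using h by (simp add: w_def b_def)
  next
    case (Suc k)
    have "2 * (w (k + 1) - u (k + 1)) \<le> 2 * (w (k + 1) - u (k + 1)) * cosh h"
      using Suc cosh_real_ge_1[of h] by (simp add: mult_le_cancel_left1)
    also have "\<dots> \<le> w (k + 2) + w k - (u (k + 2) + u k)"
      using w_rec[of k] rec[of k] by (simp add: algebra_simps)
    finally show ?case using Suc by simp
  qed
  then show ?thesis by (simp add: w_def b_def)
qed

text \<open>Along the segment from \<open>p\<close> to \<open>p + v\<close> the two-point inequality
  is a discrete form of \<open>u'' \<le> a\<^sup>2 * u\<close> with \<open>a = D * norm v\<close>.
  Comparison on a grid of mesh \<open>1 / n\<close>, followed by a limit in \<open>n\<close>, turns
  the initial slope into \<open>L v\<close>.\<close>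

lemma cosh_norm_upper_expansion:
  fixes p :: "'a::real_normed_vector"
  assumes sm: "two_smooth TYPE('a) D" and D: "D \<ge> 1"
  obtains L where "bounded_linear L" "\<And>v. cosh (norm p) + L v \<le> cosh (norm (p + v))"
    "\<And>v. \<bar>L v\<bar> \<le> cosh (norm p) * norm v"
    "\<And>v. v \<noteq> 0 \<Longrightarrow> cosh (norm (p + v))
       \<le> cosh (norm p) * cosh (D * norm v) + L v / (D * norm v) * sinh (D * norm v)"
proof -
  let ?g = "\<lambda>x::'a. cosh (norm x)"
  have cosh_lim: "((\<lambda>t. (cosh (c * t) - 1) / t) \<longlongrightarrow> 0) (at_right 0)" for c :: real
  proof -
    have "((\<lambda>t. cosh (c * t)) has_field_derivative 0) (at 0)"
      by (auto intro!: derivative_eq_intros)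
    then show ?thesis
      by (auto simp: has_field_derivative_iff intro: tendsto_mono[OF at_le])
  qed
  have sinh_lim: "((\<lambda>t. sinh (c * t) / t) \<longlongrightarrow> c) (at_right 0)" for c :: real
  proof -
    have "((\<lambda>t. sinh (c * t)) has_field_derivative c) (at 0)"
      by (auto intro!: derivative_eq_intros)
    then show ?thesis
      by (auto simp: has_field_derivative_iff intro: tendsto_mono[OF at_le])
  qed
  \<comment> \<open>Convexity bounds the second difference below by 0; the two-point inequality
    bounds it above by a multiple of \<open>cosh (D * norm v * t) - 1\<close>, which is of smaller
    order than \<open>t\<close>.\<close>
  have smooth: "((\<lambda>t. (?g (p + t *\<^sub>R v) + ?g (p - t *\<^sub>R v) - 2 * ?g p) / t) \<longlongrightarrow> 0) (at_right 0)" for v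
  proof (rule tendsto_sandwich[where f = "\<lambda>_. 0"])
    show "\<forall>\<^sub>F t in at_right 0. 0 \<le> (?g (p + t *\<^sub>R v) + ?g (p - t *\<^sub>R v) - 2 * ?g p) / t"
    proof (rule eventually_at_right_less[THEN eventually_mono])
      fix t :: real assume t: "t > 0"
      have half: "a + w + (a - w) = a + a" for a w :: 'a
        by simp
      have "(1/2) *\<^sub>R (p + t *\<^sub>R v) + (1/2) *\<^sub>R (p - t *\<^sub>R v) = (1/2) *\<^sub>R p + (1/2) *\<^sub>R p"
        by (simp only: scaleR_add_right scaleR_diff_right) (rule half)
      also have "\<dots> = p" by (simp flip: scaleR_add_left)
      finally show "0 \<le> (?g (p + t *\<^sub>R v) + ?g (p - t *\<^sub>R v) - 2 * ?g p) / t"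
        using convex_onD[OF convex_cosh_norm, of "1/2" "p + t *\<^sub>R v" "p - t *\<^sub>R v"] t by simp
    qed
    show "((\<lambda>t. 2 * ?g p * ((cosh ((D * norm v) * t) - 1) / t)) \<longlongrightarrow> 0) (at_right 0)"
      by (rule tendsto_mult_right_zero[OF cosh_lim])
    show "\<forall>\<^sub>F t in at_right 0. (?g (p + t *\<^sub>R v) + ?g (p - t *\<^sub>R v) - 2 * ?g p) / t
        \<le> 2 * ?g p * ((cosh ((D * norm v) * t) - 1) / t)"
    proof (rule eventually_at_right_less[THEN eventually_mono])
      fix t :: real assume t: "t > 0"
      have "?g (p + t *\<^sub>R v) + ?g (p - t *\<^sub>R v) - 2 * ?g p \<le> 2 * ?g p * (cosh ((D * norm v) * t) - 1)"
        using cosh_norm_midpoint[OF sm D, of p "t *\<^sub>R v"] t by (simp add: algebra_simps)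
      then show "(?g (p + t *\<^sub>R v) + ?g (p - t *\<^sub>R v) - 2 * ?g p) / t
          \<le> 2 * ?g p * ((cosh ((D * norm v) * t) - 1) / t)"
        using t by (simp add: divide_right_mono)
    qed
  qed simp
  obtain L where L: "bounded_linear L" "\<And>v. ?g p + L v \<le> ?g (p + v)"
      "\<And>v. \<bar>L v\<bar> \<le> cosh (norm p) * norm v"
      and L_lim: "\<And>v. ((\<lambda>t. (?g (p + t *\<^sub>R v) - ?g p) / t) \<longlongrightarrow> L v) (at_right 0)"
    using convex_smooth_directional_derivative[OF convex_cosh_norm smooth cosh_norm_lower] by blast
  moreover have "?g (p + v) \<le> ?g p * cosh a + L v / a * sinh a"
    if v: "v \<noteq> 0" and a_def: "a = D * norm v" for v a
  proof (rule tendsto_lowerbound)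
    have a: "a > 0" using v D by (simp add: a_def)
    \<comment> \<open>The comparison bound for mesh \<open>t\<close>, rewritten through difference
      quotients whose limits are known.\<close>
    let ?R = "\<lambda>t. ?g p * cosh a
      + ((?g (p + t *\<^sub>R v) - ?g p) / t - ?g p * ((cosh (a * t) - 1) / t)) / (sinh (a * t) / t) * sinh a"
    have "(?R \<longlongrightarrow> ?g p * cosh a + (L v - ?g p * 0) / a * sinh a) (at_right 0)"
      using a by (intro tendsto_intros L_lim cosh_lim sinh_lim) auto
    then have "(?R \<longlongrightarrow> ?g p * cosh a + L v / a * sinh a) (at_right 0)"
      by simp
    moreover have "filterlim (\<lambda>n. inverse (real n)) (at_right 0) sequentially"
      using filterlim_compose[OF filterlim_inverse_at_right_top filterlim_real_sequentially] .
    ultimately show "(\<lambda>n. ?R (inverse (real n))) \<longlonglongrightarrow> ?g p * cosh a + L v / a * sinh a"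
      by (rule filterlim_compose)
    show "\<forall>\<^sub>F n in sequentially. ?g (p + v) \<le> ?R (inverse (real n))"
    proof (rule eventually_mono[OF eventually_gt_at_top[of 0]])
      fix n :: nat assume n: "n > 0"
      define t where "t = inverse (real n)"
      have t: "t > 0" "real n * t = 1" using n by (simp_all add: t_def)
      define u where "u k = ?g (p + (real k * t) *\<^sub>R v)" for k
      have "u (k + 2) + u k \<le> 2 * u (k + 1) * cosh (a * t)" for k
      proof -
        have "real (k + 2) * t = real (k + 1) * t + t" "real k * t = real (k + 1) * t - t"
          by (simp_all add: algebra_simps)
        then have "u (k + 2) = ?g ((p + (real (k + 1) * t) *\<^sub>R v) + t *\<^sub>R v)"
          and "u k = ?g ((p + (real (k + 1) * t) *\<^sub>R v) - t *\<^sub>R v)"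
          by (simp_all only: u_def scaleR_left_distrib scaleR_left_diff_distrib add.assoc add_diff_eq)
        moreover have "a * t = D * norm (t *\<^sub>R v)"
          using t(1) by (simp add: a_def)
        ultimately show ?thesis
          using cosh_norm_midpoint[OF sm D, of "p + (real (k + 1) * t) *\<^sub>R v" "t *\<^sub>R v"]
          by (simp only: u_def)
      qed
      from discrete_cosh_comparison[OF _ this, of n]
      have "u n \<le> u 0 * cosh (real n * (a * t)) + (u 1 - u 0 * cosh (a * t)) / sinh (a * t) * sinh (real n * (a * t))"
        using a t by simp
      moreover have "real n * (a * t) = a"
        using t(2) by (simp add: mult.left_commute)
      moreover have "u n = ?g (p + v)" "u 0 = ?g p" "u 1 = ?g (p + t *\<^sub>R v)"
        using t(2) by (simp_all add: u_def)
      ultimately have "?g (p + v) \<le> ?g p * cosh a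
          + (?g (p + t *\<^sub>R v) - ?g p * cosh (a * t)) / sinh (a * t) * sinh a"
        by simp
      also have "(?g (p + t *\<^sub>R v) - ?g p * cosh (a * t)) / sinh (a * t)
          = ((?g (p + t *\<^sub>R v) - ?g p) / t - ?g p * ((cosh (a * t) - 1) / t)) / (sinh (a * t) / t)"
        using t(1) a by (simp add: field_simps)
      finally show "?g (p + v) \<le> ?R (inverse (real n))"
        by (simp only: t_def)
    qed
  qed simp
  ultimately show thesis using that by blast
qed

section \<open>Exponential tilting by \<open>psi_E\<close>\<close>

lemma psi_E_nonneg: "0 \<le> l \<Longrightarrow> l < 1 \<Longrightarrow> 0 \<le> psi_E l"
  using ln_le_minus_one[of "1 - l"] by (simp add: psi_E_def)

text \<open>Both sides vanish at \<open>l = 0\<close>, and the derivative in \<open>l\<close> of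
  right minus left is \<open>l * x\<^sup>2 * (1 / (1 - l) - 1 / (1 - l * x))\<close>, which is
  nonnegative because \<open>l * x \<le> l\<close>.\<close>

lemma psi_E_mult_le:
  assumes l: "0 \<le> l" "l < 1" and x: "0 \<le> x" "x \<le> 1"
  shows "psi_E (l * x) \<le> psi_E l * x\<^sup>2"
proof -
  let ?g = "\<lambda>s. psi_E s * x\<^sup>2 - psi_E (s * x)"
  have "?g 0 \<le> ?g l"
  proof (rule DERIV_nonneg_imp_nondecreasing[OF l(1)])
    fix s assume s: "0 \<le> s" "s \<le> l"
    have sx: "s * x \<le> s"
      using s x by (simp add: mult_left_le)
    then have pos: "1 - s > 0" "1 - s * x > 0"
      using s l by auto
    have "(?g has_real_derivative (1 / (1 - s) - 1) * x\<^sup>2 - (x / (1 - s * x) - x)) (at s)"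
      unfolding psi_E_def using pos by (auto intro!: derivative_eq_intros)
    moreover have "(1 / (1 - s) - 1) * x\<^sup>2 - (x / (1 - s * x) - x)
        = s * x\<^sup>2 * (1 / (1 - s) - 1 / (1 - s * x))"
      using pos by (simp add: field_simps power2_eq_square)
    moreover have "\<dots> \<ge> 0"
      using s sx pos by (intro mult_nonneg_nonneg) (auto intro!: divide_left_mono)
    ultimately show "\<exists>y. (?g has_real_derivative y) (at s) \<and> 0 \<le> y"
      by metis
  qed
  then show ?thesis by (simp add: psi_E_def)
qed

text \<open>With \<open>u = l * x\<close> it suffices to treat \<open>psi_E u\<close>. For the minus
  sign \<open>exp (- psi_E u - u)\<close> equals \<open>1 - u\<close>; for the plus sign the claim
  is \<open>ln (1 - u) + 2 * u \<le> ln (1 + u)\<close>, proved by differentiation.\<close>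

lemma exp_psi_E_bounds:
  assumes l: "0 \<le> l" "l < 1" and x: "0 \<le> x" "x \<le> 1"
  shows "exp (- (psi_E l * x\<^sup>2)) * exp (l * x) \<le> 1 + l * x"
    and "exp (- (psi_E l * x\<^sup>2)) * exp (- (l * x)) \<le> 1 - l * x"
proof -
  let ?u = "l * x"
  have u: "0 \<le> ?u" "?u < 1"
    using l x mult_left_le[of x l] by auto
  have le: "exp (- (psi_E l * x\<^sup>2)) \<le> exp (- psi_E ?u)"
    using psi_E_mult_le[OF assms] by simp
  have eq: "exp (- psi_E ?u) * exp (- ?u) = 1 - ?u"
    using u by (simp add: psi_E_def flip: exp_add)
  show "exp (- (psi_E l * x\<^sup>2)) * exp (- ?u) \<le> 1 - ?u"
    using mult_right_mono[OF le, of "exp (- ?u)"] eq by simp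
  let ?g = "\<lambda>s. ln (1 + s) - ln (1 - s) - 2 * s :: real"
  have "?g 0 \<le> ?g ?u"
  proof (rule DERIV_nonneg_imp_nondecreasing[OF u(1)])
    fix s assume s: "0 \<le> s" "s \<le> ?u"
    then have pos: "1 + s > 0" "1 - s > 0" using u by auto
    have "(?g has_real_derivative 1 / (1 + s) + 1 / (1 - s) - 2) (at s)"
      using pos by (auto intro!: derivative_eq_intros)
    moreover have "1 / (1 + s) + 1 / (1 - s) - 2 = 2 * s\<^sup>2 / ((1 + s) * (1 - s))"
      using pos by (simp add: divide_simps) (simp add: algebra_simps power2_eq_square)
    moreover have "2 * s\<^sup>2 / ((1 + s) * (1 - s)) \<ge> 0" using pos by simp
    ultimately show "\<exists>y. (?g has_real_derivative y) (at s) \<and> 0 \<le> y"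
      by (intro exI[of _ "1 / (1 + s) + 1 / (1 - s) - 2"] conjI) (assumption, simp only:)
  qed
  then have "- psi_E ?u + ?u \<le> ln (1 + ?u)"
    by (simp add: psi_E_def)
  then have "exp (- psi_E ?u) * exp ?u \<le> 1 + ?u"
    using u by (simp add: ln_ge_iff flip: exp_add)
  then show "exp (- (psi_E l * x\<^sup>2)) * exp ?u \<le> 1 + ?u"
    by (rule order_trans[OF mult_right_mono[OF le], rotated]) simp
qed

text \<open>The left-hand side is affine in \<open>s\<close>, so only the endpoints have to be checked.\<close>

lemma cosh_sinh_psi_E_le:
  assumes l: "0 \<le> l" "l < 1" and x: "0 \<le> x" "x \<le> 1" and a: "a = l * x" "a > 0"
    and s: "\<bar>s\<bar> \<le> c * a"
  shows "(c * cosh a + s / a * sinh a) * exp (- (psi_E l * x\<^sup>2)) \<le> c + s"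
proof -
  let ?e = "exp (- (psi_E l * x\<^sup>2))"
  define r where "r = s / a"
  have r: "\<bar>r\<bar> \<le> c"
    using s a by (simp add: r_def field_simps)
  \<comment> \<open>Since \<open>\<bar>r\<bar> \<le> c\<close>, the weights
    \<open>(c + r) / 2\<close> and \<open>(c - r) / 2\<close> are nonnegative, so the two
    exponential bounds can be added with these weights.\<close>
  have "(c * cosh a + r * sinh a) * ?e
      = (c + r) / 2 * (?e * exp a) + (c - r) / 2 * (?e * exp (- a))"
    by (simp add: cosh_field_def sinh_field_def field_simps)
  also have "\<dots> \<le> (c + r) / 2 * (1 + a) + (c - r) / 2 * (1 - a)"
    using exp_psi_E_bounds[OF l x] r unfolding a(1)[symmetric]
    by (intro add_mono mult_left_mono) auto
  also have "\<dots> = c + r * a"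
    by (simp add: field_simps)
  also have "r * a = s"
    using a(2) by (simp add: r_def)
  finally show ?thesis
    by (simp only: r_def)
qed

text \<open>One functional \<open>L\<close> serves all \<open>v\<close>, \<open>l\<close> and
  \<open>x\<close>, so the bound can be integrated over random increments. The case
  \<open>v = 0\<close> is separate because the expansion divides by
  \<open>D * norm v\<close>.\<close>

lemma cosh_norm_psi_E_le:
  fixes p :: "'a::real_normed_vector"
  assumes sm: "two_smooth TYPE('a) D" and D: "D \<ge> 1"
  obtains L where "bounded_linear L" "\<And>v. cosh (norm p) + L v \<le> cosh (norm (p + v))"
    "\<And>v l x. \<lbrakk>0 \<le> l; l < 1; 0 \<le> x; x \<le> 1; D * norm v = l * x\<rbrakk>
       \<Longrightarrow> cosh (norm (p + v)) * exp (- (psi_E l * x\<^sup>2)) \<le> cosh (norm p) + L v"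
proof -
  obtain L where L: "bounded_linear L" "\<And>v. cosh (norm p) + L v \<le> cosh (norm (p + v))"
    "\<And>v. \<bar>L v\<bar> \<le> cosh (norm p) * norm v"
    "\<And>v. v \<noteq> 0 \<Longrightarrow> cosh (norm (p + v))
       \<le> cosh (norm p) * cosh (D * norm v) + L v / (D * norm v) * sinh (D * norm v)"
    using cosh_norm_upper_expansion[OF sm D] by blast
  have key: "cosh (norm (p + v)) * exp (- (psi_E l * x\<^sup>2)) \<le> cosh (norm p) + L v"
    if l: "0 \<le> l" "l < 1" and x: "0 \<le> x" "x \<le> 1" and eq: "D * norm v = l * x" for v l x
  proof (cases "v = 0")
    case True
    have "cosh (norm p) * exp (- (psi_E l * x\<^sup>2)) \<le> cosh (norm p) * 1"
      using psi_E_nonneg[OF l] by (intro mult_left_mono) auto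
    then show ?thesis
      using True linear_0[OF bounded_linear.linear[OF L(1)]] by simp
  next
    case False
    have "norm v \<le> D * norm v"
      using D by (simp add: mult_le_cancel_right1)
    then have "\<bar>L v\<bar> \<le> cosh (norm p) * (D * norm v)"
      by (rule order_trans[OF L(3) mult_left_mono]) simp
    then have "(cosh (norm p) * cosh (D * norm v) + L v / (D * norm v) * sinh (D * norm v))
        * exp (- (psi_E l * x\<^sup>2)) \<le> cosh (norm p) + L v"
      using False D by (intro cosh_sinh_psi_E_le[OF l x eq]) auto
    then show ?thesis
      by (rule order_trans[OF mult_right_mono[OF L(4)[OF False] exp_ge_zero]])
  qed
  show thesis
    by (rule that[OF L(1,2) key])
qed

section \<open>One update by an observation \<open>x\<close>, with the past frozen in
  \<open>f\<close>, \<open>l\<close>, \<open>m\<close>\<close>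

definition tilt :: "real \<Rightarrow> real \<Rightarrow> 'a \<Rightarrow> 'a \<Rightarrow> real \<Rightarrow> 'a \<Rightarrow> 'a::real_normed_vector \<Rightarrow> real" where
  "tilt B D \<mu> f l m x =
     cosh (norm (f + l *\<^sub>R ((x - \<mu>) /\<^sub>R (4 * B * D)))) * exp (- (psi_E l / (4 * B)\<^sup>2 * (norm (x - m))\<^sup>2))"

lemma tilt_nonneg: "0 \<le> tilt B D \<mu> f l m x"
  by (simp add: tilt_def)

text \<open>Provides the constant majorant for integrability and dominated convergence: the
  exponential factor is at most 1, and \<open>l < 1\<close> controls the increment.\<close>

lemma tilt_le:
  assumes "B > 0" "D > 0" "0 \<le> l" "l < 1" "norm f \<le> K" "norm x \<le> B"
  shows "tilt B D \<mu> f l m x \<le> cosh (K + (B + norm \<mu>) / (4 * B * D))"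
proof -
  define c where "c = 4 * B * D"
  have c: "c > 0" using assms by (simp add: c_def)
  have "norm (l *\<^sub>R ((x - \<mu>) /\<^sub>R c)) = l * (norm (x - \<mu>) / c)"
    using c assms(3) by (simp only: norm_scaleR abs_inverse abs_of_nonneg abs_of_pos) (simp add: divide_inverse)
  also have "\<dots> \<le> norm (x - \<mu>) / c"
    using c assms by (intro mult_left_le_one_le) auto
  also have "\<dots> \<le> (B + norm \<mu>) / c"
    using c assms(6) norm_triangle_ineq4[of x \<mu>] by (intro divide_right_mono) auto
  finally have le: "norm (f + l *\<^sub>R ((x - \<mu>) /\<^sub>R c)) \<le> K + (B + norm \<mu>) / c"
    using assms(5) norm_triangle_ineq[of f "l *\<^sub>R ((x - \<mu>) /\<^sub>R c)"] by linarith
  have "cosh (norm (f + l *\<^sub>R ((x - \<mu>) /\<^sub>R c))) \<le> cosh (K + (B + norm \<mu>) / c)"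
    by (rule iffD2[OF cosh_real_nonneg_le_iff[OF norm_ge_zero order_trans[OF norm_ge_zero le]] le])
  moreover have "exp (- (psi_E l / (4 * B)\<^sup>2 * (norm (x - m))\<^sup>2)) \<le> 1"
    using psi_E_nonneg[of l] assms by simp
  ultimately have "tilt B D \<mu> f l m x \<le> cosh (K + (B + norm \<mu>) / c) * 1"
    unfolding tilt_def c_def by (intro mult_mono) auto
  then show ?thesis by (simp add: c_def)
qed

lemma tendsto_tilt:
  assumes "(f \<longlongrightarrow> f') F" "(l \<longlongrightarrow> l') F" "(m \<longlongrightarrow> m') F" "l' < 1"
  shows "((\<lambda>n. tilt B D \<mu> (f n) (l n) (m n) x) \<longlongrightarrow> tilt B D \<mu> f' l' m' x) F"
  unfolding tilt_def psi_E_def divide_inverse using assms by (auto intro!: tendsto_intros)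

lemma measurable_tilt [measurable (raw)]:
  fixes f m x :: "'w \<Rightarrow> 'a::{banach, second_countable_topology}"
  assumes [measurable]: "f \<in> borel_measurable N" "l \<in> borel_measurable N" "m \<in> borel_measurable N"
    "x \<in> borel_measurable N"
  shows "(\<lambda>w. tilt B D \<mu> (f w) (l w) (m w) (x w)) \<in> borel_measurable N"
proof -
  have [measurable]: "(cosh :: real \<Rightarrow> real) \<in> borel_measurable borel"
    by (intro borel_measurable_continuous_onI continuous_intros)
  show ?thesis
    unfolding tilt_def psi_E_def by measurable
qed

text \<open>Expanding \<open>cosh \<circ> norm\<close> around \<open>p = f + l (m - \<mu>) / (4 B D)\<close> instead of \<open>f\<close> makes the increment
  proportional to \<open>Y - m\<close>, the quantity penalised in \<open>tilt\<close>. The mean of the linear term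
  is then \<open>L (f - p)\<close>, and convexity brings \<open>p\<close> back to \<open>f\<close>.\<close>

lemma tilt_set_integral_le_const:
  fixes Y :: "'w \<Rightarrow> 'a::{banach, second_countable_topology}"
  assumes "prob_space M" and sm: "two_smooth TYPE('a) D" and D: "D \<ge> 1" and B: "B > 0"
    and Y: "integrable M Y" "AE w in M. norm (Y w) \<le> B"
    and A: "A \<in> sets M" "(LINT w:A|M. Y w) = (LINT w:A|M. \<mu>)"
    and l: "0 \<le> l" "l < 1" and m: "norm m \<le> 3 * B"
  shows "integrable M (\<lambda>w. tilt B D \<mu> f l m (Y w))"
    and "(LINT w:A|M. tilt B D \<mu> f l m (Y w)) \<le> measure M A * cosh (norm f)"
proof -
  interpret prob_space M by fact
  define s where "s = l / (4 * B * D)"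
  define p where "p = f + s *\<^sub>R (m - \<mu>)"
  have s: "s \<ge> 0" "D * s = l / (4 * B)"
    using l B D by (simp_all add: s_def)
  obtain L where L: "bounded_linear L" "\<And>v. cosh (norm p) + L v \<le> cosh (norm (p + v))"
    and L_tilt: "\<And>v l x. \<lbrakk>0 \<le> l; l < 1; 0 \<le> x; x \<le> 1; D * norm v = l * x\<rbrakk>
       \<Longrightarrow> cosh (norm (p + v)) * exp (- (psi_E l * x\<^sup>2)) \<le> cosh (norm p) + L v"
    using cosh_norm_psi_E_le[OF sm D, of p] by blast
  interpret L: bounded_linear L by fact
  have [measurable]: "Y \<in> borel_measurable M" "A \<in> sets M"
    using Y A by auto
  let ?h = "\<lambda>w. cosh (norm p) + L (s *\<^sub>R (Y w - m))"
  have le: "tilt B D \<mu> f l m y \<le> cosh (norm p) + L (s *\<^sub>R (y - m))" if "norm y \<le> B" for y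
  proof -
    \<comment> \<open>From \<open>norm m \<le> 3 * B\<close> and \<open>norm y \<le> B\<close>; this
      quotient plays the role of \<open>x\<close> in the exponential bounds.\<close>
    have "norm (y - m) / (4 * B) \<le> 1"
      using norm_triangle_ineq4[of y m] that m B by simp
    moreover have "D * norm (s *\<^sub>R (y - m)) = l * (norm (y - m) / (4 * B))"
      by (simp only: norm_scaleR abs_of_nonneg[OF s(1)] mult.assoc[symmetric] s(2)) simp
    moreover have "f + l *\<^sub>R ((y - \<mu>) /\<^sub>R (4 * B * D)) = p + s *\<^sub>R (y - m)"
    proof -
      have "l *\<^sub>R ((y - \<mu>) /\<^sub>R (4 * B * D)) = s *\<^sub>R (y - \<mu>)"
        by (simp only: s_def scaleR_scaleR divide_inverse)
      moreover have "y - \<mu> = (m - \<mu>) + (y - m)"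
        by simp
      ultimately show ?thesis
        by (simp only: p_def scaleR_add_right add.assoc)
    qed
    ultimately show ?thesis
      using L_tilt[OF l, of "norm (y - m) / (4 * B)" "s *\<^sub>R (y - m)"] B
      by (simp add: tilt_def power_divide)
  qed
  have int_v: "integrable M (\<lambda>w. s *\<^sub>R (Y w - m))"
    using Y by auto
  have int_h: "integrable M ?h"
    using integrable_bounded_linear[OF L(1) int_v] by auto
  have AE_le: "AE w in M. tilt B D \<mu> f l m (Y w) \<le> ?h w"
    using Y(2) by eventually_elim (rule le)
  show int_tilt: "integrable M (\<lambda>w. tilt B D \<mu> f l m (Y w))"
    using AE_le by (intro Bochner_Integration.integrable_bound[OF int_h])
      (auto elim!: eventually_mono intro: order_trans[OF _ abs_ge_self] simp: tilt_nonneg)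
  have const: "(LINT w:A|M. c) = measure M A *\<^sub>R c" for c :: 'a
    unfolding set_lebesgue_integral_def by (subst integral_scaleR_left) (auto simp: emeasure_eq_measure)
  have "(LINT w:A|M. tilt B D \<mu> f l m (Y w)) \<le> (LINT w:A|M. ?h w)"
    unfolding set_lebesgue_integral_def
    using AE_le int_tilt int_h
    by (intro integral_mono_AE integrable_mult_indicator) (auto elim!: eventually_mono intro: mult_left_mono)
  also have "\<dots> = (LINT w:A|M. cosh (norm p)) + (LINT w:A|M. L (s *\<^sub>R (Y w - m)))"
    by (intro set_integral_add(2); unfold set_integrable_def)
      (intro integrable_mult_indicator integrable_const integrable_bounded_linear[OF L(1) int_v]; simp)+
  also have "(LINT w:A|M. L (s *\<^sub>R (Y w - m))) = L (LINT w:A|M. s *\<^sub>R (Y w - m))"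
    unfolding set_lebesgue_integral_def L.scaleR[symmetric]
    by (intro integral_bounded_linear L(1) integrable_mult_indicator int_v) simp
  also have "(LINT w:A|M. s *\<^sub>R (Y w - m)) = s *\<^sub>R ((LINT w:A|M. Y w) - (LINT w:A|M. m))"
    by (subst set_integral_diff(2)[symmetric]; (unfold set_integrable_def)?)
      (intro integrable_mult_indicator integrable_const Y(1); simp | simp)+
  \<comment> \<open>On \<open>A\<close> the mean of \<open>Y\<close> may be replaced by
    \<open>\<mu>\<close>, and \<open>s *\<^sub>R (\<mu> - m) = f - p\<close> by the choice of
    \<open>p\<close>.\<close>
  also have "\<dots> = measure M A *\<^sub>R (f - p)"
    by (simp only: A(2) const p_def) (simp add: algebra_simps)
  also have "(LINT w:A|M. cosh (norm p)) + L (measure M A *\<^sub>R (f - p)) = measure M A * (cosh (norm p) + L (f - p))"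
    by (simp add: set_lebesgue_integral_def L.scaleR distrib_left)
  also have "\<dots> \<le> measure M A * cosh (norm f)"
    using L(2)[of "f - p"] by (intro mult_left_mono) auto
  finally show "(LINT w:A|M. tilt B D \<mu> f l m (Y w)) \<le> measure M A * cosh (norm f)" .
qed

text \<open>\<open>A\<close> splits into finitely many sets in \<open>F\<close> on which
  \<open>T\<close> is constant. The bound for constants applies on each piece with its own
  functional, and the pieces are summed.\<close>

lemma tilt_set_integral_le_simple:
  fixes Y :: "'w \<Rightarrow> 'a::{banach, second_countable_topology}" and T :: "'w \<Rightarrow> 'a \<times> real \<times> 'a"
  assumes "prob_space M" and sm: "two_smooth TYPE('a) D" and D: "D \<ge> 1" and B: "B > 0"
    and Y: "is_cond_exp M F Y (\<lambda>_. \<mu>)" "AE w in M. norm (Y w) \<le> B"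
    and A: "A \<in> sets F" and T: "simple_function F T"
    and l: "\<And>w. 0 \<le> fst (snd (T w))" "\<And>w. fst (snd (T w)) < 1"
    and m: "\<And>w. w \<in> space M \<Longrightarrow> norm (snd (snd (T w))) \<le> 3 * B"
  shows "(LINT w:A|M. tilt B D \<mu> (fst (T w)) (fst (snd (T w))) (snd (snd (T w))) (Y w))
    \<le> (LINT w:A|M. cosh (norm (fst (T w))))"
proof -
  interpret prob_space M by fact
  let ?h = "\<lambda>k w. tilt B D \<mu> (fst k) (fst (snd k)) (snd (snd k)) (Y w)"
  let ?A = "\<lambda>k. A \<inter> (T -` {k} \<inter> space M)"
  have sub: "space F = space M" "sets F \<subseteq> sets M" and int_Y: "integrable M Y"
    and ce: "\<And>A. A \<in> sets F \<Longrightarrow> (LINT w:A|M. Y w) = (LINT w:A|M. \<mu>)"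
    using Y(1) unfolding is_cond_exp_def subalgebra_def by auto
  have fin: "finite (T ` space M)"
    using T sub by (simp add: simple_function_def)
  have A_F: "?A k \<in> sets F" for k
    using A simple_functionD(2)[OF T, of "{k}"] sub by auto
  have A_M: "?A k \<in> sets M" for k
    using A_F sub by blast
  have split: "(\<Sum>k\<in>T ` space M. indicator (?A k) w *\<^sub>R g k w) = indicator A w *\<^sub>R g (T w) w"
    if "w \<in> space M" for w and g :: "_ \<Rightarrow> _ \<Rightarrow> real"
    by (subst sum.remove[OF fin imageI[OF that]])
      (auto intro!: sum.neutral simp: that indicator_def)
  have step: "integrable M (?h k)" "(LINT w:?A k|M. ?h k w) \<le> measure M (?A k) * cosh (norm (fst k))"
    if "k \<in> T ` space M" for k
    using that l m
    by (auto intro!: tilt_set_integral_le_const[OF assms(1) sm D B int_Y Y(2) A_M ce[OF A_F]])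
  have "(LINT w:A|M. ?h (T w) w) = (LINT w|M. (\<Sum>k\<in>T ` space M. indicator (?A k) w *\<^sub>R ?h k w))"
    unfolding set_lebesgue_integral_def by (intro Bochner_Integration.integral_cong refl split[symmetric])
  also have "\<dots> = (\<Sum>k\<in>T ` space M. LINT w:?A k|M. ?h k w)"
    unfolding set_lebesgue_integral_def
    by (intro Bochner_Integration.integral_sum integrable_mult_indicator A_M step)
  also have "\<dots> \<le> (\<Sum>k\<in>T ` space M. measure M (?A k) * cosh (norm (fst k)))"
    by (intro sum_mono step)
  also have "\<dots> = (\<Sum>k\<in>T ` space M. LINT w|M. indicator (?A k) w *\<^sub>R cosh (norm (fst k)))"
    using A_M by (intro sum.cong) auto
  also have "\<dots> = (LINT w|M. (\<Sum>k\<in>T ` space M. indicator (?A k) w *\<^sub>R cosh (norm (fst k))))"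
    by (intro Bochner_Integration.integral_sum[symmetric] integrable_mult_indicator A_M integrable_const)
  also have "\<dots> = (LINT w:A|M. cosh (norm (fst (T w))))"
    unfolding set_lebesgue_integral_def by (intro Bochner_Integration.integral_cong refl split)
  finally show ?thesis .
qed

section \<open>Conditional expectations\<close>

text \<open>The past is approximated pointwise by simple functions of \<open>F\<close>, and both
  sides pass to the limit by dominated convergence.\<close>

lemma tilt_set_integral_le:
  fixes Y :: "'w \<Rightarrow> 'a::{banach, second_countable_topology}"
  assumes "prob_space M" and sm: "two_smooth TYPE('a) D" and D: "D \<ge> 1" and B: "B > 0"
    and Y: "is_cond_exp M F Y (\<lambda>_. \<mu>)" "AE w in M. norm (Y w) \<le> B"
    and A: "A \<in> sets F"
    and meas: "f \<in> borel_measurable F" "l \<in> borel_measurable F" "m \<in> borel_measurable F"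
    and f: "\<And>w. w \<in> space M \<Longrightarrow> norm (f w) \<le> K"
    and l: "\<And>w. w \<in> space M \<Longrightarrow> l w \<in> {0..c}" and c: "0 \<le> c" "c < 1"
    and m: "\<And>w. w \<in> space M \<Longrightarrow> norm (m w) \<le> B"
  shows "(LINT w:A|M. tilt B D \<mu> (f w) (l w) (m w) (Y w)) \<le> (LINT w:A|M. cosh (norm (f w)))"
proof -
  interpret prob_space M by fact
  have sub: "subalgebra M F" and space: "space F = space M" and A_M [measurable]: "A \<in> sets M"
    and Y_M [measurable]: "Y \<in> borel_measurable M"
    using Y(1) A unfolding is_cond_exp_def subalgebra_def by auto
  note meas_M [measurable] = meas[THEN measurable_from_subalg[OF sub]]
  obtain fn where fn: "\<And>n. simple_function F (fn n)" "\<And>w. w \<in> space M \<Longrightarrow> (\<lambda>n. fn n w) \<longlonglongrightarrow> f w"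
      "\<And>n w. w \<in> space M \<Longrightarrow> dist (fn n w) 0 \<le> 2 * dist (f w) 0"
    using borel_measurable_implies_sequence_metric[OF meas(1), of 0] unfolding space by blast
  obtain gn where gn: "\<And>n. simple_function F (gn n)" "\<And>w. w \<in> space M \<Longrightarrow> (\<lambda>n. gn n w) \<longlonglongrightarrow> l w"
    using borel_measurable_implies_sequence_metric[OF meas(2), of 0] unfolding space by blast
  obtain mn where mn: "\<And>n. simple_function F (mn n)" "\<And>w. w \<in> space M \<Longrightarrow> (\<lambda>n. mn n w) \<longlonglongrightarrow> m w"
      "\<And>n w. w \<in> space M \<Longrightarrow> dist (mn n w) 0 \<le> 2 * dist (m w) 0"
    using borel_measurable_implies_sequence_metric[OF meas(3), of 0] unfolding space by blast
  \<comment> \<open>Clamping keeps the approximating weights away from 1, where \<open>psi_E\<close>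
    is singular, and leaves the limit \<open>l w\<close> unchanged.\<close>
  define ln where "ln n w = max 0 (min c (gn n w))" for n w
  have ln_simple: "simple_function F (ln n)" for n
    unfolding ln_def by (rule simple_function_compose1[OF gn(1)])
  have ln_range: "0 \<le> ln n w" "ln n w \<le> c" for n w
    using c by (auto simp: ln_def)
  have ln_lim: "(\<lambda>n. ln n w) \<longlonglongrightarrow> l w" if "w \<in> space M" for w
  proof -
    have "(\<lambda>n. ln n w) \<longlonglongrightarrow> max 0 (min c (l w))"
      unfolding ln_def by (intro tendsto_intros gn(2) that)
    then show ?thesis using l[OF that] by simp
  qed
  have fn_bound: "norm (fn n w) \<le> 2 * K" if "w \<in> space M" for n w
    using fn(3)[OF that, of n] f[OF that] by simp
  \<comment> \<open>The approximation may double the norm, giving \<open>2 * B\<close>; this is why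
    the preceding lemmas allow more than \<open>B\<close>.\<close>
  have mn_bound: "norm (mn n w) \<le> 3 * B" if "w \<in> space M" for n w
    using mn(3)[OF that, of n] m[OF that] B by simp
  have [measurable]: "fn n \<in> borel_measurable M" "ln n \<in> borel_measurable M" "mn n \<in> borel_measurable M" for n
    by (rule measurable_from_subalg[OF sub borel_measurable_simple_function], rule fn(1) ln_simple mn(1))+
  have [measurable]: "(cosh :: real \<Rightarrow> real) \<in> borel_measurable borel"
    by (intro borel_measurable_continuous_onI continuous_intros)
  have le: "(LINT w:A|M. tilt B D \<mu> (fn n w) (ln n w) (mn n w) (Y w)) \<le> (LINT w:A|M. cosh (norm (fn n w)))" for n
    using tilt_set_integral_le_simple[OF assms(1) sm D B Y A, of "\<lambda>w. (fn n w, ln n w, mn n w)"]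
      fn(1) ln_simple mn(1) ln_range(1) le_less_trans[OF ln_range(2) c(2)] mn_bound
    by (auto intro!: simple_function_Pair)
  have lim1: "(\<lambda>n. LINT w:A|M. tilt B D \<mu> (fn n w) (ln n w) (mn n w) (Y w))
      \<longlonglongrightarrow> (LINT w:A|M. tilt B D \<mu> (f w) (l w) (m w) (Y w))"
    unfolding set_lebesgue_integral_def
  proof (rule integral_dominated_convergence)
    let ?w = "\<lambda>_. cosh (2 * K + (B + norm \<mu>) / (4 * B * D))"
    show "AE w in M. (\<lambda>n. indicator A w *\<^sub>R tilt B D \<mu> (fn n w) (ln n w) (mn n w) (Y w))
        \<longlonglongrightarrow> indicator A w *\<^sub>R tilt B D \<mu> (f w) (l w) (m w) (Y w)"
      using l c by (intro AE_I2 tendsto_scaleR tendsto_const tendsto_tilt fn(2) ln_lim mn(2))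
        (auto intro: le_less_trans)
    show "AE w in M. norm (indicator A w *\<^sub>R tilt B D \<mu> (fn n w) (ln n w) (mn n w) (Y w)) \<le> ?w w" for n
      using Y(2) AE_space
    proof eventually_elim
      case (elim w)
      have "tilt B D \<mu> (fn n w) (ln n w) (mn n w) (Y w) \<le> ?w w"
        using elim fn_bound ln_range[of n w] B D c by (intro tilt_le) auto
      then show ?case
        using tilt_nonneg[of B D \<mu> "fn n w" "ln n w" "mn n w" "Y w"] by (auto simp: indicator_def)
    qed
  qed auto
  have lim2: "(\<lambda>n. LINT w:A|M. cosh (norm (fn n w))) \<longlonglongrightarrow> (LINT w:A|M. cosh (norm (f w)))"
    unfolding set_lebesgue_integral_def
  proof (rule integral_dominated_convergence)
    show "AE w in M. (\<lambda>n. indicator A w *\<^sub>R cosh (norm (fn n w))) \<longlonglongrightarrow> indicator A w *\<^sub>R cosh (norm (f w))"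
      by (intro AE_I2 tendsto_intros fn(2))
    show "AE w in M. norm (indicator A w *\<^sub>R cosh (norm (fn n w))) \<le> cosh (2 * K)" for n
    proof (rule AE_I2)
      fix w assume "w \<in> space M"
      then have "cosh (norm (fn n w)) \<le> cosh (2 * K)"
        using fn_bound order_trans[OF norm_ge_zero fn_bound] by (simp add: cosh_real_nonneg_le_iff)
      then show "norm (indicator A w *\<^sub>R cosh (norm (fn n w))) \<le> cosh (2 * K)"
        by (auto simp: indicator_def)
    qed
  qed auto
  show ?thesis
    using LIMSEQ_le[OF lim1 lim2] le by blast
qed

text \<open>Test the hypothesis on the set in \<open>F\<close> where the conditional expectation
  exceeds \<open>g\<close>: the excess is nonnegative there with integral at most 0, so the set is
  null.\<close>

lemma (in sigma_finite_subalgebra) real_cond_exp_le_charact: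
  assumes [measurable]: "integrable M f" "integrable M g" "g \<in> borel_measurable F"
    and le: "\<And>A. A \<in> sets F \<Longrightarrow> (LINT w:A|M. f w) \<le> (LINT w:A|M. g w)"
  shows "AE w in M. real_cond_exp M F f w \<le> g w"
proof -
  let ?h = "real_cond_exp M F f"
  define A where "A = {w \<in> space F. g w < ?h w}"
  have A_F: "A \<in> sets F" unfolding A_def by measurable
  then have [measurable]: "A \<in> sets M" using subalg by (auto simp: subalgebra_def)
  have int_h: "integrable M ?h" by (rule real_cond_exp_int(1)[OF assms(1)])
  have int: "integrable M (\<lambda>w. indicator A w *\<^sub>R ?h w)" "integrable M (\<lambda>w. indicator A w *\<^sub>R g w)"
    by (intro integrable_mult_indicator int_h assms; simp)+
  have nonneg: "0 \<le> indicator A w *\<^sub>R ?h w - indicator A w *\<^sub>R g w" for w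
    by (auto simp: A_def indicator_def)
  have "(LINT w:A|M. ?h w) \<le> (LINT w:A|M. g w)"
    using real_cond_exp_intA[OF assms(1) A_F] le[OF A_F] by simp
  then have "(LINT w|M. indicator A w *\<^sub>R ?h w - indicator A w *\<^sub>R g w) \<le> 0"
    using int by (simp add: set_lebesgue_integral_def)
  moreover have "0 \<le> (LINT w|M. indicator A w *\<^sub>R ?h w - indicator A w *\<^sub>R g w)"
    by (intro Bochner_Integration.integral_nonneg nonneg)
  ultimately have "(LINT w|M. indicator A w *\<^sub>R ?h w - indicator A w *\<^sub>R g w) = 0"
    by linarith
  then have "AE w in M. indicator A w *\<^sub>R ?h w - indicator A w *\<^sub>R g w = 0"
    using integral_nonneg_eq_0_iff_AE[OF Bochner_Integration.integrable_diff[OF int] AE_I2[OF nonneg]] by blast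
  then show ?thesis
    using AE_space
  proof eventually_elim
    case (elim w)
    show ?case
    proof (rule ccontr)
      assume "\<not> ?h w \<le> g w"
      then have "w \<in> A" using elim(2) subalg by (simp add: A_def subalgebra_def)
      then show False using elim(1) \<open>\<not> ?h w \<le> g w\<close> by simp
    qed
  qed
qed

lemma tilt_cond_exp_le:
  fixes Y :: "'w \<Rightarrow> 'a::{banach, second_countable_topology}"
  assumes "prob_space M" and sm: "two_smooth TYPE('a) D" and D: "D \<ge> 1" and B: "B > 0"
    and Y: "is_cond_exp M F Y (\<lambda>_. \<mu>)" "AE w in M. norm (Y w) \<le> B"
    and meas [measurable]: "f \<in> borel_measurable F" "l \<in> borel_measurable F" "m \<in> borel_measurable F"
    and f: "AE w in M. norm (f w) \<le> K" "0 \<le> K"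
    and l: "AE w in M. l w \<in> {0..c}" "0 \<le> c" "c < 1"
    and m: "AE w in M. norm (m w) \<le> B"
  shows "AE w in M. real_cond_exp M F (\<lambda>w. tilt B D \<mu> (f w) (l w) (m w) (Y w)) w \<le> cosh (norm (f w))"
proof -
  interpret prob_space M by fact
  have sub: "subalgebra M F" and space: "space F = space M" and Y_M [measurable]: "Y \<in> borel_measurable M"
    using Y(1) unfolding is_cond_exp_def subalgebra_def by auto
  interpret finite_measure_subalgebra M F
    by unfold_locales fact
  have [measurable]: "(cosh :: real \<Rightarrow> real) \<in> borel_measurable borel"
    by (intro borel_measurable_continuous_onI continuous_intros)
  \<comment> \<open>The bounds hold only almost everywhere, whereas the integral inequality wants
    them pointwise. These truncations stay \<open>F\<close>-measurable and change the past only on a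
    null set.\<close>
  define f' where "f' w = (if norm (f w) \<le> K then f w else 0)" for w
  define l' where "l' w = max 0 (min c (l w))" for w
  define m' where "m' w = (if norm (m w) \<le> B then m w else 0)" for w
  have meas' [measurable]: "f' \<in> borel_measurable F" "l' \<in> borel_measurable F" "m' \<in> borel_measurable F"
    unfolding f'_def l'_def m'_def by measurable
  note [measurable] = meas[THEN measurable_from_subalg[OF sub]] meas'[THEN measurable_from_subalg[OF sub]]
  have eq: "AE w in M. f' w = f w \<and> l' w = l w \<and> m' w = m w"
    using f(1) l(1) m by eventually_elim (auto simp: f'_def l'_def m'_def)
  show ?thesis
  proof (rule real_cond_exp_le_charact)
    show "integrable M (\<lambda>w. tilt B D \<mu> (f w) (l w) (m w) (Y w))"
    proof (rule integrable_const_bound)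
      show "AE w in M. norm (tilt B D \<mu> (f w) (l w) (m w) (Y w)) \<le> cosh (K + (B + norm \<mu>) / (4 * B * D))"
        using f(1) l(1) Y(2)
      proof eventually_elim
        case (elim w)
        then show ?case
          using tilt_le[of B D "l w" "f w" K "Y w" \<mu> "m w"] B D l(3) by (simp add: tilt_nonneg)
      qed
    qed measurable
    show "integrable M (\<lambda>w. cosh (norm (f w)))"
    proof (rule integrable_const_bound)
      show "AE w in M. norm (cosh (norm (f w))) \<le> cosh K"
        using f(1) by eventually_elim (simp add: cosh_real_nonneg_le_iff f(2))
    qed measurable
    show "(\<lambda>w. cosh (norm (f w))) \<in> borel_measurable F"
      by measurable
    fix A assume A: "A \<in> sets F"
    have [measurable]: "A \<in> sets M" using A sub by (auto simp: subalgebra_def)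
    have "(LINT w:A|M. tilt B D \<mu> (f w) (l w) (m w) (Y w)) = (LINT w:A|M. tilt B D \<mu> (f' w) (l' w) (m' w) (Y w))"
      unfolding set_lebesgue_integral_def
      by (intro integral_cong_AE eventually_mono[OF eq]) auto
    also have "\<dots> \<le> (LINT w:A|M. cosh (norm (f' w)))"
      using f(2) l(2) B
      by (intro tilt_set_integral_le[OF assms(1) sm D B Y A meas', of K c])
        (auto simp: f'_def l'_def m'_def l(3))
    also have "\<dots> = (LINT w:A|M. cosh (norm (f w)))"
      unfolding set_lebesgue_integral_def
      by (intro integral_cong_AE eventually_mono[OF eq]) auto
    finally show "(LINT w:A|M. tilt B D \<mu> (f w) (l w) (m w) (Y w)) \<le> (LINT w:A|M. cosh (norm (f w)))" .
  qed
qed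

section \<open>The supermartingale\<close>

lemma space_nat_filt: "space (nat_filt M X t) = space M"
  and sets_nat_filt: "sets (nat_filt M X t)
    = sigma_sets (space M) {X i -` A \<inter> space M | i A. i \<in> {1..t} \<and> A \<in> sets borel}"
proof -
  have "{X i -` A \<inter> space M | i A. i \<in> {1..t} \<and> A \<in> sets borel} \<subseteq> Pow (space M)"
    by auto
  then show "space (nat_filt M X t) = space M" "sets (nat_filt M X t)
    = sigma_sets (space M) {X i -` A \<inter> space M | i A. i \<in> {1..t} \<and> A \<in> sets borel}"
    unfolding nat_filt_def by (auto simp: space_measure_of_conv sets_measure_of)
qed

lemma nat_filt_mono: "s \<le> t \<Longrightarrow> subalgebra (nat_filt M X t) (nat_filt M X s)"
  unfolding subalgebra_def space_nat_filt sets_nat_filt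
  by (auto intro!: sigma_sets_mono' intro: order_trans)

lemma measurable_nat_filt: "i \<in> {1..t} \<Longrightarrow> X i \<in> borel_measurable (nat_filt M X t)"
  by (rule measurableI) (auto simp: space_nat_filt sets_nat_filt intro!: sigma_sets.Basic)

lemma measurable_mu_bar:
  fixes X :: "nat \<Rightarrow> 'w \<Rightarrow> 'a::{banach, second_countable_topology}"
  assumes "\<And>j. j \<in> {1..i} \<Longrightarrow> lam j \<in> borel_measurable N" "\<And>j. j \<in> {1..i} \<Longrightarrow> X j \<in> borel_measurable N"
  shows "mu_bar lam X i \<in> borel_measurable N"
proof (cases "i = 0")
  case False
  have "(\<lambda>w. (\<Sum>j=1..i. lam j w *\<^sub>R X j w) /\<^sub>R (\<Sum>j=1..i. lam j w)) \<in> borel_measurable N"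
    using assms by (intro borel_measurable_scaleR borel_measurable_inverse borel_measurable_sum)
  then show ?thesis
    using False by (simp add: mu_bar_def[abs_def])
qed (simp add: mu_bar_def[abs_def])

lemma norm_mu_bar_le:
  assumes "\<And>j. j \<in> {1..i} \<Longrightarrow> lam j w > 0" "\<And>j. j \<in> {1..i} \<Longrightarrow> norm (X j w) \<le> B" "B \<ge> 0"
  shows "norm (mu_bar lam X i w) \<le> B"
proof (cases "i = 0")
  case False
  have pos: "(\<Sum>j=1..i. lam j w) > 0"
    using assms(1) False by (intro sum_pos) auto
  have "norm (\<Sum>j=1..i. lam j w *\<^sub>R X j w) \<le> (\<Sum>j=1..i. lam j w * B)"
    using assms by (intro sum_norm_le) (auto intro!: mult_left_mono simp: less_imp_le)
  also have "\<dots> = (\<Sum>j=1..i. lam j w) * B"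
    by (simp add: sum_distrib_right)
  finally have "norm (\<Sum>j=1..i. lam j w *\<^sub>R X j w) / (\<Sum>j=1..i. lam j w) \<le> B"
    using pos by (simp add: pos_divide_le_eq mult.commute)
  moreover have "norm (mu_bar lam X i w) = norm (\<Sum>j=1..i. lam j w *\<^sub>R X j w) / (\<Sum>j=1..i. lam j w)"
    using pos False by (simp add: mu_bar_def divide_inverse_commute)
  ultimately show ?thesis by simp
qed (use assms in \<open>simp add: mu_bar_def\<close>)

theorem theorem1:
  fixes M :: "'w measure"
    and X :: "nat \<Rightarrow> 'w \<Rightarrow> 'a::{banach, second_countable_topology}"
    and \<mu> :: 'a
    and lam :: "nat \<Rightarrow> 'w \<Rightarrow> real"
    and B D :: real
  assumes "prob_space M"
    and "two_smooth TYPE('a) D"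
    and "\<exists>x::'a. x \<noteq> 0"
    and "B > 0"
    and "\<And>t. t \<ge> 1 \<Longrightarrow> X t \<in> borel_measurable M"
    and "\<And>t. is_cond_exp M (nat_filt M X t) (X (t + 1)) (\<lambda>_. \<mu>)"
    and "\<And>t. t \<ge> 1 \<Longrightarrow> AE w in M. norm (X t w) \<le> B"
    and "is_predictable (nat_filt M X) lam"
    and "\<And>t. t \<ge> 1 \<Longrightarrow> AE w in M. lam t w \<in> {0<..0.8}"
  shows "is_supermartingale M (nat_filt M X) (S_proc B D \<mu> lam X)
         \<and> (\<forall>t. \<forall>w\<in>space M. 0 \<le> S_proc B D \<mu> lam X t w)
         \<and> (\<forall>w\<in>space M. S_proc B D \<mu> lam X 0 w = 1)"
proof -
  interpret prob_space M by fact
  have D: "D \<ge> 1"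
    by (rule two_smooth_ge_1[OF assms(2,3)])
  note B = \<open>B > 0\<close>
  let ?F = "nat_filt M X" and ?S = "S_proc B D \<mu> lam X"
  let ?d = "\<lambda>i w. lam i w *\<^sub>R ((X i w - \<mu>) /\<^sub>R (4 * B * D))"
  let ?c = "\<lambda>i w. psi_E (lam i w) / (4 * B)\<^sup>2 * (norm (X i w - mu_bar lam X (i - 1) w))\<^sup>2"
  \<comment> \<open>The process factors as \<open>cosh (norm (f t w)) * W t w\<close>, and
    \<open>K t\<close> is a deterministic bound for \<open>norm (f t w)\<close> off a null
    set.\<close>
  define f where "f t w = (\<Sum>i=1..t. ?d i w)" for t w
  define W where "W t w = exp (- (\<Sum>i=1..t. ?c i w))" for t w
  define K where "K t = real t * ((B + norm \<mu>) / (4 * B * D))" for t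
  have K: "K t \<ge> 0" for t
    using B D by (simp add: K_def)
  have S_eq: "?S t w = cosh (norm (f t w)) * W t w" for t w
    by (simp add: S_proc_def f_def W_def)
  \<comment> \<open>Isolates the new observation: apart from \<open>X (t + 1)\<close>, every
    quantity on the right is known at time \<open>t\<close>.\<close>
  have S_Suc: "?S (t + 1) w = W t w * tilt B D \<mu> (f t w) (lam (t + 1) w) (mu_bar lam X t w) (X (t + 1) w)" for t w
  proof -
    have "(\<Sum>i=1..t + 1. ?d i w) = (\<Sum>i=1..t. ?d i w) + ?d (t + 1) w"
      and "(\<Sum>i=1..t + 1. ?c i w) = (\<Sum>i=1..t. ?c i w) + ?c (t + 1) w"
      by simp_all
    then show ?thesis
      by (simp only: S_proc_def f_def W_def tilt_def minus_add_distrib exp_add add_diff_cancel_right' mult_ac)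
  qed
  have sub: "subalgebra M (?F t)" for t
    using assms(6) by (simp add: is_cond_exp_def)
  have X_meas: "X i \<in> borel_measurable (?F t)" if "i \<in> {1..t}" for i t
    using that by (rule measurable_nat_filt)
  \<comment> \<open>The range reaches \<open>t + 1\<close> because predictability makes the next
    weight known at time \<open>t\<close>.\<close>
  have lam_meas: "lam i \<in> borel_measurable (?F t)" if "i \<in> {1..t + 1}" for i t
    using assms(8) that unfolding is_predictable_def
    by (intro measurable_from_subalg[OF nat_filt_mono[of "i - 1" t]]) auto
  have mu_bar_meas: "mu_bar lam X i \<in> borel_measurable (?F t)" if "i \<le> t" for i t
    using that by (intro measurable_mu_bar lam_meas X_meas) auto
  have f_meas: "f t \<in> borel_measurable (?F t)" for t
    unfolding f_def
    by (intro borel_measurable_sum borel_measurable_scaleR borel_measurable_diff borel_measurable_const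
        X_meas lam_meas) auto
  have [measurable]: "(cosh :: real \<Rightarrow> real) \<in> borel_measurable borel"
    by (intro borel_measurable_continuous_onI continuous_intros)
  have [measurable]: "psi_E \<in> borel_measurable borel"
    unfolding psi_E_def[abs_def] by measurable
  have W_meas: "W t \<in> borel_measurable (?F t)" for t
  proof -
    have "(\<lambda>w. ?c i w) \<in> borel_measurable (?F t)" if "i \<in> {1..t}" for i
    proof -
      have [measurable]: "lam i \<in> borel_measurable (?F t)" "X i \<in> borel_measurable (?F t)"
        "mu_bar lam X (i - 1) \<in> borel_measurable (?F t)"
        using that by (auto intro: lam_meas X_meas mu_bar_meas)
      show ?thesis by measurable
    qed
    then have [measurable]: "(\<lambda>w. \<Sum>i=1..t. ?c i w) \<in> borel_measurable (?F t)"
      by (rule borel_measurable_sum)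
    show ?thesis unfolding W_def[abs_def] by measurable
  qed
  have S_meas: "?S t \<in> borel_measurable (?F t)" for t
  proof -
    note [measurable] = f_meas[of t] W_meas[of t]
    show ?thesis unfolding S_eq[abs_def] by measurable
  qed
  \<comment> \<open>Countably many almost sure bounds are collected into one event, on which the
    estimates are pointwise.\<close>
  define good where "good w \<longleftrightarrow> (\<forall>i\<ge>1. norm (X i w) \<le> B \<and> lam i w \<in> {0<..0.8})" for w
  have good: "AE w in M. good w"
    unfolding good_def AE_all_countable using assms(7,9) by auto
  have f_le: "norm (f t w) \<le> K t" if "good w" for t w
  proof -
    have "norm (?d i w) \<le> (B + norm \<mu>) / (4 * B * D)" if i: "i \<in> {1..t}" for i
    proof -
      have "0 < lam i w" "lam i w \<le> 0.8" "norm (X i w) \<le> B"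
        using \<open>good w\<close> i by (auto simp: good_def)
      define c where "c = 4 * B * D"
      have c: "c > 0" using B D by (simp add: c_def)
      have "norm (lam i w *\<^sub>R ((X i w - \<mu>) /\<^sub>R c)) = lam i w * (norm (X i w - \<mu>) / c)"
        using c \<open>0 < lam i w\<close> by (simp only: norm_scaleR abs_inverse abs_of_pos) (simp add: divide_inverse)
      also have "\<dots> \<le> norm (X i w - \<mu>) / c"
        using c \<open>0 < lam i w\<close> \<open>lam i w \<le> 0.8\<close> by (intro mult_left_le_one_le) auto
      also have "\<dots> \<le> (B + norm \<mu>) / c"
        using c \<open>norm (X i w) \<le> B\<close> norm_triangle_ineq4[of "X i w" \<mu>] by (intro divide_right_mono) auto
      finally show ?thesis by (simp only: c_def)
    qed
    then have "norm (f t w) \<le> (\<Sum>i=1..t. (B + norm \<mu>) / (4 * B * D))"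
      unfolding f_def by (rule sum_norm_le)
    then show ?thesis by (simp add: K_def)
  qed
  have W_le: "W t w \<le> 1" if "good w" for t w
  proof -
    have "(\<Sum>i=1..t. ?c i w) \<ge> 0"
    proof (rule sum_nonneg)
      fix i assume "i \<in> {1..t}"
      then have "psi_E (lam i w) \<ge> 0"
        using that by (intro psi_E_nonneg) (auto simp: good_def less_imp_le intro: le_less_trans)
      then show "?c i w \<ge> 0" by simp
    qed
    then show ?thesis by (simp add: W_def)
  qed
  have S_nonneg: "0 \<le> ?S t w" for t w
    by (simp add: S_eq W_def)
  have S_int: "integrable M (?S t)" for t
  proof (rule integrable_const_bound)
    show "AE w in M. norm (?S t w) \<le> cosh (K t)"
      using good
    proof eventually_elim
      case (elim w)
      have "cosh (norm (f t w)) \<le> cosh (K t)"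
        using f_le[OF elim] K by (simp add: cosh_real_nonneg_le_iff)
      then have "?S t w \<le> cosh (K t) * 1"
        unfolding S_eq using W_le[OF elim] by (intro mult_mono) (auto simp: W_def)
      then show ?case using S_nonneg[of t w] by simp
    qed
    show "?S t \<in> borel_measurable M"
      by (rule measurable_from_subalg[OF sub S_meas])
  qed
  have step: "AE w in M. real_cond_exp M (?F t) (?S (t + 1)) w \<le> ?S t w" for t
  proof -
    interpret finite_measure_subalgebra M "?F t"
      by unfold_locales (rule sub)
    let ?G = "\<lambda>w. tilt B D \<mu> (f t w) (lam (t + 1) w) (mu_bar lam X t w) (X (t + 1) w)"
    have S_fun: "?S (t + 1) = (\<lambda>w. W t w * ?G w)"
      by (rule ext) (rule S_Suc)
    have meas: "f t \<in> borel_measurable (?F t)" "lam (t + 1) \<in> borel_measurable (?F t)"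
      "mu_bar lam X t \<in> borel_measurable (?F t)"
      by (auto intro: f_meas lam_meas mu_bar_meas)
    have "AE w in M. real_cond_exp M (?F t) ?G w \<le> cosh (norm (f t w))"
    proof (rule tilt_cond_exp_le[OF assms(1,2) D B assms(6) _ meas, where K = "K t" and c = "0.8"])
      show "AE w in M. norm (X (t + 1) w) \<le> B"
        using good by eventually_elim (simp add: good_def)
      show "AE w in M. lam (t + 1) w \<in> {0..0.8}"
        using good by eventually_elim (simp add: good_def less_imp_le)
      show "AE w in M. norm (f t w) \<le> K t"
        using good by eventually_elim (rule f_le)
      show "AE w in M. norm (mu_bar lam X t w) \<le> B"
        using good by eventually_elim (intro norm_mu_bar_le; use B in \<open>auto simp: good_def\<close>)
    qed (auto simp: K)
    \<comment> \<open>The accumulated penalty \<open>W t\<close> is known at time \<open>t\<close>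
      and comes out of the conditional expectation.\<close>
    moreover have "AE w in M. real_cond_exp M (?F t) (\<lambda>w. W t w * ?G w) w = W t w * real_cond_exp M (?F t) ?G w"
    proof (rule real_cond_exp_mult[OF W_meas])
      show "?G \<in> borel_measurable M"
        using meas[THEN measurable_from_subalg[OF sub]] assms(5)[of "t + 1"] by (intro measurable_tilt) auto
      show "integrable M (\<lambda>w. W t w * ?G w)"
        using S_int[of "t + 1"] unfolding S_fun .
    qed
    ultimately show ?thesis
    proof eventually_elim
      case (elim w)
      have "W t w * real_cond_exp M (?F t) ?G w \<le> W t w * cosh (norm (f t w))"
        using elim(1) by (intro mult_left_mono) (auto simp: W_def)
      then show ?case
        using elim(2) unfolding S_fun S_eq by (simp only: mult.commute)
    qed
  qed
  have "filtration (space M) ?F"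
    using nat_filt_mono[of _ _ M X] by unfold_locales (auto simp: subalgebra_def space_nat_filt)
  then have "is_supermartingale M ?F ?S"
    using sub S_meas S_int step by (simp add: is_supermartingale_def)
  moreover have "?S 0 w = 1" for w
    by (simp add: S_proc_def)
  ultimately show ?thesis
    using S_nonneg by simp
qed

end
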